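(* Let $K,N,M_a\ge 1$ be integers, let $W,\sigma^2,\eta,P_{\max}>0$, $C_{\min}\ge0$ and $P_{\rm c}:=M_aP_{\rm dyn}+P_{\rm sta}>0$, and let $\mathbf H_1,\dots,\mathbf H_K\in\mathbb C^{N\times M_a}$ be nonzero matrices. For $\mathbf Q=(\mathbf Q_1,\dots,\mathbf Q_K)$ with Hermitian positive semidefinite $\mathbf Q_i\in\mathbb C^{N\times N}$ put $$R(\mathbf Q)=W\log_2\Big|\mathbf I+\frac1{\sigma^2}\sum_{i=1}^K\mathbf H_i^H\mathbf Q_i\mathbf H_i\Big|,\qquad p(\mathbf Q)=\sum_{i=1}^K\mathrm{Tr}(\mathbf Q_i),\qquad g(\mathbf Q)=\frac{R(\mathbf Q)}{p(\mathbf Q)/\eta+P_{\rm c}} .$$ Let $\mathbf Q^*$ be a maximizer of $g$ over all such $\mathbf Q$, let $\hat{\mathbf Q}$ be a maximizer of $R$ subject to $p(\mathbf Q)\le P_{\max}$, let $\bar{\mathbf Q}$ be a minimizer of $p$ subject to $R(\mathbf Q)\ge C_{\min}$, and let $P^*=p(\mathbf Q^* )$, $\bar P=p(\bar{\mathbf Q})$. Consider the constrained problem $$\max_{\mathbf Q_1\succeq0,\dots,\mathbf Q_K\succeq 0}\ g(\mathbf Q)\quad\text{subject to}\quad p(\mathbf Q)\le P_{\max},\quad R(\mathbf Q)\ge C_{\min}.$$ Then: (i) if $\bar P\le P^*\le P_{\max}$, then $\mathbf Q^*$ is an optimal solution; (ii) if $P^*\ge P_{\max}\ge\bar P$, then $\hat{\mathbf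 Q}$ is an optimal solution; (iii) if $P^*\le\bar P\le P_{\max}$, then $\bar{\mathbf Q}$ is an optimal solution; (iv) if $\bar P>P_{\max}$, then the problem is infeasible.
   Context: $|\cdot|$ denotes the determinant, $^H$ the conjugate transpose, $\mathbf Q_i\succeq0$ means Hermitian positive semidefinite. $R$ is the sum-rate of the dual MIMO multiple-access channel with user channel matrices $\mathbf H_i$ and transmit covariances $\mathbf Q_i$, $p$ the sum transmit power, $g$ the energy efficiency; $W$ is the bandwidth, $\sigma^2$ the noise power, $\eta$ the power amplifier efficiency, $M_aP_{\rm dyn}+P_{\rm sta}$ the transmit-independent power, $P_{\max}$ the maximum sum transmit power and $C_{\min}$ the minimum sum-rate. *)

theory Defs
  imports "HOL-Analysis.Analysis"
begin

definition conj_transpose :: "complex^'m^'n \<Rightarrow> complex^'n^'m" where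
  "conj_transpose A = (\<chi> i j. cnj (A $ j $ i))"

definition hermitian :: "complex^'n^'n \<Rightarrow> bool" where
  "hermitian A \<longleftrightarrow> conj_transpose A = A"

(* The sum is x^H A x; it is real because A is Hermitian, so taking Re only changes its type. *)
definition pos_semidef :: "complex^'n^'n \<Rightarrow> bool" where
  "pos_semidef A \<longleftrightarrow>
     hermitian A \<and> (\<forall>x :: complex^'n. Re (\<Sum>i\<in>UNIV. cnj (x $ i) * (A *v x) $ i) \<ge> 0)"

(* A family (Q_1, ..., Q_K) is a function on a finite index type 'k with K = CARD('k);
   likewise N = CARD('n) and M_a = CARD('m), so H i :: complex^'m^'n has N rows, M_a columns. *)

definition covariances :: "('k::finite \<Rightarrow> complex^'n^'n) \<Rightarrow> bool" where
  "covariances Q \<longleftrightarrow> (\<forall>i. pos_semidef (Q i))"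

definition rate_matrix ::
  "real \<Rightarrow> ('k::finite \<Rightarrow> complex^'m^'n) \<Rightarrow> ('k \<Rightarrow> complex^'n^'n) \<Rightarrow> complex^'m^'m" where
  "rate_matrix \<sigma>sq H Q =
     mat 1 + (1 / \<sigma>sq) *\<^sub>R (\<Sum>i\<in>UNIV. conj_transpose (H i) ** Q i ** H i)"

(* On covariances the determinant and the traces below are real (see the lemmas at the end),
   so Re only changes their type. *)

definition sum_rate ::
  "real \<Rightarrow> real \<Rightarrow> ('k::finite \<Rightarrow> complex^'m^'n) \<Rightarrow> ('k \<Rightarrow> complex^'n^'n) \<Rightarrow> real" where
  "sum_rate W \<sigma>sq H Q = W * log 2 (Re (det (rate_matrix \<sigma>sq H Q)))"

definition sum_power :: "('k::finite \<Rightarrow> complex^'n^'n) \<Rightarrow> real" where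
  "sum_power Q = (\<Sum>i\<in>UNIV. Re (trace (Q i)))"

definition energy_efficiency ::
  "real \<Rightarrow> real \<Rightarrow> real \<Rightarrow> real \<Rightarrow> ('k::finite \<Rightarrow> complex^'m^'n) \<Rightarrow> ('k \<Rightarrow> complex^'n^'n) \<Rightarrow> real"
where
  "energy_efficiency W \<sigma>sq \<eta> Pc H Q = sum_rate W \<sigma>sq H Q / (sum_power Q / \<eta> + Pc)"

definition feasible ::
  "real \<Rightarrow> real \<Rightarrow> real \<Rightarrow> real \<Rightarrow> ('k::finite \<Rightarrow> complex^'m^'n) \<Rightarrow> ('k \<Rightarrow> complex^'n^'n) \<Rightarrow> bool"
where
  "feasible W \<sigma>sq Pmax Cmin H Q \<longleftrightarrow>
     covariances Q \<and> sum_power Q \<le> Pmax \<and> sum_rate W \<sigma>sq H Q \<ge> Cmin"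

lemma conj_transpose_mult: "conj_transpose (A ** B) = conj_transpose B ** conj_transpose A"
  by (simp add: conj_transpose_def matrix_matrix_mult_def vec_eq_iff mult.commute)

lemma conj_transpose_conj_transpose [simp]: "conj_transpose (conj_transpose A) = A"
  by (simp add: conj_transpose_def vec_eq_iff)

lemma trace_hermitian_real:
  assumes "hermitian A"
  shows "Im (trace A) = 0"
proof -
  have "cnj (A $ i $ i) = A $ i $ i" for i
    using assms by (simp add: hermitian_def conj_transpose_def vec_eq_iff)
  then have "Im (A $ i $ i) = 0" for i
    by (metis Reals_cnj_iff complex_is_Real_iff)
  then show ?thesis
    by (simp add: trace_def)
qed

lemma det_conj_transpose: "det (conj_transpose A) = cnj (det A)"
proof -
  have "det (conj_transpose A) = det (\<chi> i j. cnj (A $ i $ j))"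
    by (subst det_transpose [symmetric]) (simp add: conj_transpose_def transpose_def)
  also have "\<dots> = cnj (det A)"
    by (simp add: det_def)
  finally show ?thesis .
qed

lemma det_hermitian_real:
  assumes "hermitian A"
  shows "Im (det A) = 0"
  using det_conj_transpose [of A] assms
  by (metis Reals_cnj_iff complex_is_Real_iff hermitian_def)

lemma hermitian_rate_matrix:
  assumes "covariances Q"
  shows "hermitian (rate_matrix \<sigma>sq H Q)"
proof -
  have "conj_transpose (conj_transpose (H i) ** Q i ** H i) = conj_transpose (H i) ** Q i ** H i" for i
    using assms
    by (simp add: covariances_def pos_semidef_def hermitian_def conj_transpose_mult matrix_mul_assoc)
  then have "cnj ((conj_transpose (H i) ** Q i ** H i) $ b $ a) = (conj_transpose (H i) ** Q i ** H i) $ a $ b"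
    for i a b
    by (metis (no_types) conj_transpose_def vec_lambda_beta)
  then show ?thesis
    by (simp add: hermitian_def rate_matrix_def conj_transpose_def [of "_ + _"] vec_eq_iff mat_def)
qed

end

theory Submission
  imports Defs "HOL-Computational_Algebra.Fundamental_Theorem_Algebra"
begin

text \<open>Write \<open>R\<close>, \<open>p\<close>, \<open>g\<close> for rate, power and efficiency. Since \<open>R\<close> is concave and \<open>p\<close> is affine,
  \<open>g\<close> is quasiconcave, so moving from a feasible \<open>Q\<close> towards the global maximizer \<open>Q\<^sup>*\<close> never
  decreases \<open>g\<close>. In cases (ii) and (iii) the segment from \<open>Q\<close> to \<open>Q\<^sup>*\<close> crosses the power level of
  the claimed optimum, and among points of that power the claimed optimum has the largest rate. For
  the minimum power point this last claim uses that a strictly larger rate would leave room to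
  scale the covariances down.

  Concavity of \<open>log det\<close> on a segment \<open>A + t (B - A)\<close> follows from the fact that its determinant
  is \<open>det A\<close> times a product of real linear factors \<open>1 + t a\<close>.\<close>

section \<open>Hermitian forms, positive definite and semidefinite matrices\<close>

text \<open>Kept complex-valued because it is later evaluated in an equation containing a complex
  root \<open>z\<close> that is not yet known to be real.\<close>

definition herm_form :: "complex^'n^'n \<Rightarrow> complex^'n \<Rightarrow> complex" where
  "herm_form A x = (\<Sum>i\<in>UNIV. cnj (x $ i) * (A *v x) $ i)"

definition pos_def :: "complex^'n^'n \<Rightarrow> bool" where
  "pos_def A \<longleftrightarrow> hermitian A \<and> (\<forall>x. x \<noteq> 0 \<longrightarrow> Re (herm_form A x) > 0)"

lemma pos_semidef_iff:
  "pos_semidef A \<longleftrightarrow> hermitian A \<and> (\<forall>x. Re (herm_form A x) \<ge> 0)"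
  by (simp add: pos_semidef_def herm_form_def)

lemma matrix_scaleR_vector_mult: "(c *\<^sub>R A) *v x = c *\<^sub>R (A *v (x :: complex^'n))"
  by (simp add: matrix_vector_mult_def vec_eq_iff scaleR_sum_right)

lemma herm_form_add: "herm_form (A + B) x = herm_form A x + herm_form B x"
  by (simp add: herm_form_def matrix_vector_mult_add_rdistrib distrib_left sum.distrib)

lemma herm_form_diff: "herm_form (A - B) x = herm_form A x - herm_form B x"
  using herm_form_add [of "A - B" B x] by simp

lemma herm_form_scaleR: "herm_form (c *\<^sub>R A) x = c *\<^sub>R herm_form A x"
  by (simp add: herm_form_def matrix_scaleR_vector_mult scaleR_sum_right)

lemma herm_form_zero [simp]: "herm_form 0 x = 0"
  by (simp add: herm_form_def)

lemma herm_form_sum: "herm_form (\<Sum>i\<in>S. A i) x = (\<Sum>i\<in>S. herm_form (A i) x)"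
  by (induction S rule: infinite_finite_induct) (auto simp: herm_form_add)

text \<open>Moving a matrix across the inner product yields both the congruence rule for forms and
  the realness of Hermitian forms.\<close>

lemma conj_transpose_adjoint:
  "(\<Sum>i\<in>UNIV. cnj (x $ i) * (conj_transpose H *v y) $ i) =
   (\<Sum>j\<in>UNIV. cnj ((H *v x) $ j) * y $ j)"
proof -
  have "(\<Sum>i\<in>UNIV. cnj (x $ i) * (conj_transpose H *v y) $ i) =
        (\<Sum>i\<in>UNIV. \<Sum>j\<in>UNIV. cnj (x $ i) * (cnj (H $ j $ i) * y $ j))"
    by (simp add: matrix_vector_mult_def conj_transpose_def sum_distrib_left)
  also have "\<dots> = (\<Sum>j\<in>UNIV. \<Sum>i\<in>UNIV. cnj (x $ i) * (cnj (H $ j $ i) * y $ j))"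
    by (rule sum.swap)
  also have "\<dots> = (\<Sum>j\<in>UNIV. cnj ((H *v x) $ j) * y $ j)"
    by (simp add: matrix_vector_mult_def sum_distrib_left mult_ac)
  finally show ?thesis .
qed

lemma herm_form_congruence:
  "herm_form (conj_transpose H ** Q ** H) x = herm_form Q (H *v x)"
  by (simp add: herm_form_def conj_transpose_adjoint flip: matrix_vector_mul_assoc)

lemma herm_form_real:
  assumes "hermitian A"
  shows "herm_form A x = complex_of_real (Re (herm_form A x))"
proof -
  have "herm_form A x = (\<Sum>j\<in>UNIV. cnj ((A *v x) $ j) * x $ j)"
    using conj_transpose_adjoint [of x A x] assms by (simp add: herm_form_def hermitian_def)
  also have "\<dots> = cnj (herm_form A x)"
    by (simp add: herm_form_def mult.commute)
  finally show ?thesis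
    by (metis Reals_cnj_iff of_real_Re)
qed

lemma hermitian_add: "hermitian A \<Longrightarrow> hermitian B \<Longrightarrow> hermitian (A + B)"
  by (simp add: hermitian_def conj_transpose_def vec_eq_iff)

lemma hermitian_diff: "hermitian A \<Longrightarrow> hermitian B \<Longrightarrow> hermitian (A - B)"
  by (simp add: hermitian_def conj_transpose_def vec_eq_iff)

lemma hermitian_scaleR: "hermitian A \<Longrightarrow> hermitian (c *\<^sub>R A)"
  by (simp add: hermitian_def conj_transpose_def vec_eq_iff)

lemma Re_cnj_mult_self: "Re (cnj z * z) = (cmod z)\<^sup>2"
  by (metis Re_complex_of_real complex_norm_square mult.commute)

lemma Re_herm_form_mat_1: "Re (herm_form (mat 1) x) = (norm x)\<^sup>2"
  by (simp add: herm_form_def norm_vec_def L2_set_def sum_nonneg flip: Re_cnj_mult_self)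

lemma hermitian_mat_1: "hermitian (mat 1)"
  by (simp add: hermitian_def conj_transpose_def mat_def vec_eq_iff)

lemma pos_def_mat_1: "pos_def (mat 1)"
  by (simp add: pos_def_def Re_herm_form_mat_1 hermitian_mat_1)

lemma pos_semidef_zero: "pos_semidef 0"
  by (simp add: pos_semidef_iff hermitian_def conj_transpose_def vec_eq_iff)

lemma pos_semidef_add: "pos_semidef A \<Longrightarrow> pos_semidef B \<Longrightarrow> pos_semidef (A + B)"
  by (simp add: pos_semidef_iff hermitian_add herm_form_add)

lemma pos_semidef_scaleR: "pos_semidef A \<Longrightarrow> c \<ge> 0 \<Longrightarrow> pos_semidef (c *\<^sub>R A)"
  by (simp add: pos_semidef_iff hermitian_scaleR herm_form_scaleR)

lemma herm_form_axis: "herm_form A (axis i 1) = A $ i $ i"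
proof -
  have "(A *v axis i 1) $ k = A $ k $ i" for k
    by (simp add: matrix_vector_mult_def axis_def if_distrib [of "\<lambda>x. _ * x"] cong: if_cong)
  then have "herm_form A (axis i 1) = (\<Sum>k\<in>UNIV. if k = i then A $ k $ i else 0)"
    unfolding herm_form_def by (intro sum.cong) (auto simp: axis_def)
  then show ?thesis
    by simp
qed

lemma pos_semidef_diag: "pos_semidef A \<Longrightarrow> Re (A $ i $ i) \<ge> 0"
  by (metis herm_form_axis pos_semidef_iff)

lemma pos_semidef_trace: "pos_semidef A \<Longrightarrow> Re (trace A) \<ge> 0"
  by (simp add: trace_def sum_nonneg pos_semidef_diag)

text \<open>Test vectors supported on two coordinates expose an off-diagonal entry; the free
  coefficient \<open>c\<close> allows the sign of the cross terms to be chosen.\<close>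

lemma herm_form_axis_add:
  assumes "i \<noteq> j"
  shows "herm_form A (axis i 1 + axis j c) =
    A $ i $ i + c * A $ i $ j + cnj c * A $ j $ i + cnj c * c * A $ j $ j"
proof -
  have m: "(A *v (axis i 1 + axis j c)) $ k = A $ k $ i + A $ k $ j * c" for k
    by (simp add: matrix_vector_mult_def axis_def distrib_left sum.distrib
        if_distrib [of "\<lambda>x. _ * x"] cong: if_cong)
  have "herm_form A (axis i 1 + axis j c) =
    (\<Sum>k\<in>UNIV. (if k = i then A $ k $ i + A $ k $ j * c else 0) +
       (if k = j then cnj c * (A $ k $ i + A $ k $ j * c) else 0))"
    unfolding herm_form_def m using assms by (intro sum.cong) (auto simp: axis_def)
  then show ?thesis
    by (simp add: sum.distrib algebra_simps)
qed

text \<open>The nonnegative diagonal entries sum to zero, so they vanish. On two coordinates only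
  the cross terms of the form then remain, and a suitable \<open>c\<close> would make them negative
  unless the off-diagonal entry is zero.\<close>

lemma pos_semidef_trace_zero:
  assumes A: "pos_semidef A" and tr: "Re (trace A) = 0"
  shows "A = 0"
proof -
  have herm: "A $ j $ i = cnj (A $ i $ j)" for i j
    using A by (simp add: pos_semidef_iff hermitian_def conj_transpose_def vec_eq_iff)
  have "Re (A $ i $ i) = 0" for i
    using tr pos_semidef_diag [OF A] by (simp add: trace_def sum_nonneg_eq_0_iff)
  moreover have "Im (A $ i $ i) = 0" for i
    using herm [of i i] by (metis complex_cnj_cancel_iff complex_is_Real_iff Reals_cnj_iff)
  ultimately have diag: "A $ i $ i = 0" for i
    by (simp add: complex_eq_iff)
  have "A $ i $ j = 0" if "i \<noteq> j" for i j
  proof -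
    \<comment> \<open>With this \<open>c\<close> each of the two cross terms equals minus the
      squared modulus of \<open>A $ i $ j\<close>.\<close>
    define c where "c = - cnj (A $ i $ j)"
    have "0 \<le> Re (herm_form A (axis i 1 + axis j c))"
      using A by (simp add: pos_semidef_iff)
    also have "\<dots> = - 2 * (cmod (A $ i $ j))\<^sup>2"
      by (simp add: herm_form_axis_add that diag herm [of j i] c_def mult.commute
          flip: Re_cnj_mult_self)
    finally show ?thesis
      by simp
  qed
  with diag show ?thesis
    by (metis (no_types, lifting) vec_eq_iff zero_index)
qed

section \<open>Determinants along Hermitian pencils and concavity of \<open>ln det\<close>\<close>

lemma of_real_prod_mset:
  "of_real (\<Prod>a\<in>#M. f a) = (\<Prod>a\<in>#M. of_real (f a) :: 'a :: {real_algebra_1, comm_semiring_1})"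
  by (induction M) auto

lemma prod_mset_ge_1: "(\<And>a. a \<in># M \<Longrightarrow> f a \<ge> (1::real)) \<Longrightarrow> (\<Prod>a\<in>#M. f a) \<ge> 1"
proof (induction M)
  case (add x M)
  then have "1 * 1 \<le> f x * (\<Prod>a\<in>#M. f a)"
    by (intro mult_mono) (auto intro: order_trans [OF zero_le_one])
  then show ?case by simp
qed simp

lemma prod_mset_pos: "(\<And>a. a \<in># M \<Longrightarrow> f a > (0::real)) \<Longrightarrow> (\<Prod>a\<in>#M. f a) > 0"
  by (induction M) auto

lemma ln_prod_mset:
  "(\<And>a. a \<in># M \<Longrightarrow> f a > (0::real)) \<Longrightarrow> ln (\<Prod>a\<in>#M. f a) = (\<Sum>a\<in>#M. ln (f a))"
  by (induction M) (auto simp: ln_mult_pos prod_mset_pos)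

text \<open>The polynomial \<open>det (A + z D)\<close> has only real roots \<open>z = - 1 / a\<close>, where \<open>a\<close> is a
  Rayleigh quotient of the pencil.\<close>

lemma det_pencil_factorization:
  fixes A D :: "complex^'n^'n"
  assumes A: "pos_def A" and D: "hermitian D"
  obtains as :: "real multiset"
  where "\<And>t::real. det (A + t *\<^sub>R D) = det A * of_real (\<Prod>a\<in>#as. 1 + t * a)"
    and "\<And>a. a \<in># as \<Longrightarrow> \<exists>v. v \<noteq> 0 \<and> a = Re (herm_form D v) / Re (herm_form A v)"
proof -
  \<comment> \<open>Taking the determinant over the polynomial ring makes the fundamental theorem of
    algebra applicable.\<close>
  define p where "p = det (\<chi> i j. [:A $ i $ j, D $ i $ j:])"
  have poly_p: "poly p z = det (\<chi> i j. A $ i $ j + z * D $ i $ j)" for z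
    by (simp add: p_def det_def poly_sum poly_prod)
  have poly_p_real: "poly p (of_real t) = det (A + t *\<^sub>R D)" for t
    unfolding poly_p by (rule arg_cong [where f = det])
      (simp add: vec_eq_iff scaleR_conv_of_real [where 'a = complex])
  \<comment> \<open>At a root the matrix is singular. Pairing a kernel vector \<open>v\<close> with
    itself gives a linear equation for \<open>z\<close> whose coefficients are real and whose
    constant term is positive, so \<open>z\<close> is real and nonzero.\<close>
  have root: "\<exists>v. v \<noteq> 0 \<and> Re (herm_form D v) \<noteq> 0 \<and>
      - 1 / z = of_real (Re (herm_form D v) / Re (herm_form A v))" if z: "poly p z = 0" for z
  proof -
    define M where "M = (\<chi> i j. A $ i $ j + z * D $ i $ j)"
    have "\<not> invertible M"
      using z invertible_det_nz [of M] unfolding poly_p M_def by simp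
    then obtain v where v: "v \<noteq> 0" "M *v v = 0"
      by (metis invertible_left_inverse matrix_left_invertible_ker)
    have "M *v v = A *v v + z *s (D *v v)"
      by (simp add: M_def matrix_vector_mult_def vec_eq_iff distrib_right sum.distrib
          sum_distrib_left mult.assoc)
    then have "(\<Sum>i\<in>UNIV. cnj (v $ i) * (A *v v + z *s (D *v v)) $ i) = 0"
      using v by simp
    then have eq: "herm_form A v + z * herm_form D v = 0"
      by (simp add: herm_form_def distrib_left sum.distrib sum_distrib_left mult_ac)
    have Av: "Re (herm_form A v) > 0"
      using A v by (simp add: pos_def_def)
    have "herm_form A v = of_real (Re (herm_form A v))" "herm_form D v = of_real (Re (herm_form D v))"
      using A D herm_form_real unfolding pos_def_def by blast+
    with eq have eq': "of_real (Re (herm_form A v)) + z * of_real (Re (herm_form D v)) = 0"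
      by simp
    with Av have "Re (herm_form D v) \<noteq> 0" "z \<noteq> 0"
      by auto
    moreover from this eq' Av have "- 1 / z = of_real (Re (herm_form D v) / Re (herm_form A v))"
      by (simp add: field_simps add_eq_0_iff)
    ultimately show ?thesis
      using v by blast
  qed
  \<comment> \<open>Since \<open>- 1 / 0 = 0\<close>, a root at 0 would make the quotient in
    \<open>root\<close> vanish, although its numerator and denominator are both nonzero.\<close>
  have p0: "poly p 0 \<noteq> 0"
    using root [of 0] A by (fastforce simp: pos_def_def)
  then have "p \<noteq> 0"
    by auto
  have p0_det: "poly p 0 = det A"
    using poly_p_real [of 0] by simp
  \<comment> \<open>The degree of \<open>p\<close> can be smaller than the matrix size; the missing
    factors are those with \<open>a = 0\<close>, which contribute 1.\<close>
  define as where "as = image_mset (\<lambda>z. Re (- 1 / z)) (proots p)"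
  have decomp: "poly p z = lead_coeff p * (\<Prod>x\<in>#proots p. z - x)" for z
  proof -
    have "poly p z = poly (smult (lead_coeff p) (\<Prod>x\<in>#proots p. [:-x, 1:])) z"
      by (simp add: complex_poly_decompose_multiset)
    also have "\<dots> = lead_coeff p * (\<Prod>x\<in>#proots p. z - x)"
      by (simp add: poly_prod_mset image_mset.compositionality o_def)
    finally show ?thesis .
  qed
  have "det (A + t *\<^sub>R D) = det A * of_real (\<Prod>a\<in>#as. 1 + t * a)" for t
  proof -
    \<comment> \<open>Each root factor is normalized to the value 1 at \<open>t = 0\<close>; the
      extracted factors \<open>0 - x\<close>, together with the leading coefficient, make up
      \<open>poly p 0 = det A\<close>.\<close>
    have *: "of_real t - x = (0 - x) * of_real (1 + t * Re (- 1 / x))" if "x \<in># proots p" for x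
    proof -
      have "poly p x = 0"
        using that \<open>p \<noteq> 0\<close> by simp
      moreover from this have "x \<noteq> 0"
        using p0 by auto
      moreover have "- 1 / x = of_real (Re (- 1 / x))"
        using root [OF \<open>poly p x = 0\<close>] by (metis Re_complex_of_real)
      ultimately have xr: "x * of_real (Re (- 1 / x)) = - 1"
        by (metis nonzero_mult_div_cancel_left times_divide_eq_right)
      have "(0 - x) * of_real (1 + t * r) = - x - of_real t * (x * of_real r)" for r
        by (simp add: algebra_simps)
      then show ?thesis
        by (simp only: xr mult_minus_right mult_1_right) simp
    qed
    have "poly p (of_real t) =
        lead_coeff p * (\<Prod>x\<in>#proots p. (0 - x) * of_real (1 + t * Re (- 1 / x)))"
      using * unfolding decomp by (metis (mono_tags, lifting) image_mset_cong)
    also have "\<dots> = poly p 0 * (\<Prod>x\<in>#proots p. of_real (1 + t * Re (- 1 / x)))"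
      unfolding decomp by (simp only: prod_mset.distrib mult.assoc)
    also have "(\<Prod>x\<in>#proots p. of_real (1 + t * Re (- 1 / x))) =
        (of_real (\<Prod>a\<in>#as. 1 + t * a) :: complex)"
      unfolding as_def by (simp add: of_real_prod_mset image_mset.compositionality o_def)
    finally show ?thesis
      using poly_p_real p0_det by simp
  qed
  moreover have "\<exists>v. v \<noteq> 0 \<and> a = Re (herm_form D v) / Re (herm_form A v)" if "a \<in># as" for a
  proof -
    obtain x where x: "x \<in># proots p" and a: "a = Re (- 1 / x)"
      using \<open>a \<in># as\<close> by (auto simp: as_def)
    then have "poly p x = 0"
      using \<open>p \<noteq> 0\<close> by simp
    with root a show ?thesis
      by (metis Re_complex_of_real)
  qed
  ultimately show ?thesis
    using that by blast
qed

text \<open>The sum is the quotient of the form of \<open>B\<close> by that of \<open>A\<close>. It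
  makes the pencil factors at \<open>t = 1\<close> positive.\<close>

lemma herm_form_ratio_pos:
  assumes "pos_def A" "pos_def B" "v \<noteq> 0"
  shows "1 + Re (herm_form (B - A) v) / Re (herm_form A v) > 0"
proof -
  have "Re (herm_form A v) > 0" "Re (herm_form B v) > 0"
    using assms by (auto simp: pos_def_def)
  then show ?thesis
    by (simp add: herm_form_diff diff_divide_distrib)
qed

text \<open>The pencil from the identity to \<open>A\<close> has only positive factors at its end
  \<open>t = 1\<close>.\<close>

lemma det_pos_def:
  fixes A :: "complex^'n^'n"
  assumes "pos_def A"
  shows "Re (det A) > 0"
proof -
  obtain as where as: "\<And>t::real. det (mat 1 + t *\<^sub>R (A - mat 1)) =
        det (mat 1 :: complex^'n^'n) * of_real (\<Prod>a\<in>#as. 1 + t * a)"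
    and ev: "\<And>a. a \<in># as \<Longrightarrow> \<exists>v. v \<noteq> 0 \<and>
        a = Re (herm_form (A - mat 1) v) / Re (herm_form (mat 1) v)"
    using det_pencil_factorization [OF pos_def_mat_1, of "A - mat 1"] assms pos_def_mat_1
    by (metis hermitian_diff pos_def_def)
  have "1 + a > 0" if "a \<in># as" for a
    using ev [OF that] herm_form_ratio_pos assms pos_def_mat_1 by blast
  then have "(\<Prod>a\<in>#as. 1 + 1 * a) > 0"
    by (intro prod_mset_pos) auto
  with as [of 1] show ?thesis
    by simp
qed

text \<open>In the pencil from the identity in direction \<open>D\<close> every Rayleigh quotient
  \<open>a\<close> is nonnegative, so every factor at \<open>t = 1\<close> is at least 1.\<close>

lemma det_one_plus_pos_semidef_ge_1:
  fixes D :: "complex^'n^'n"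
  assumes "pos_semidef D"
  shows "Re (det (mat 1 + D)) \<ge> 1"
proof -
  obtain as where as: "\<And>t::real. det (mat 1 + t *\<^sub>R D) =
        det (mat 1 :: complex^'n^'n) * of_real (\<Prod>a\<in>#as. 1 + t * a)"
    and ev: "\<And>a. a \<in># as \<Longrightarrow> \<exists>v. v \<noteq> 0 \<and>
        a = Re (herm_form D v) / Re (herm_form (mat 1) v)"
    using det_pencil_factorization [OF pos_def_mat_1, of D] assms
    by (metis pos_semidef_iff)
  have "a \<ge> 0" if "a \<in># as" for a
    using ev [OF that] assms by (auto simp: pos_semidef_iff Re_herm_form_mat_1)
  then have "(\<Prod>a\<in>#as. 1 + 1 * a) \<ge> 1"
    by (intro prod_mset_ge_1) auto
  with as [of 1] show ?thesis
    by simp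
qed

text \<open>The factorization reduces the claim to one scalar inequality for each
  \<open>a\<close>.\<close>

lemma log_det_concave:
  fixes A B :: "complex^'n^'n"
  assumes A: "pos_def A" and B: "pos_def B" and t: "0 \<le> t" "t \<le> 1"
  shows "ln (Re (det ((1 - t) *\<^sub>R A + t *\<^sub>R B))) \<ge>
    (1 - t) * ln (Re (det A)) + t * ln (Re (det B))"
proof -
  obtain as where as: "\<And>t::real. det (A + t *\<^sub>R (B - A)) =
        det A * of_real (\<Prod>a\<in>#as. 1 + t * a)"
    and ev: "\<And>a. a \<in># as \<Longrightarrow> \<exists>v. v \<noteq> 0 \<and>
        a = Re (herm_form (B - A) v) / Re (herm_form A v)"
    using det_pencil_factorization [OF A, of "B - A"] A B
    by (metis hermitian_diff pos_def_def)
  have 1: "1 + a > 0" if "a \<in># as" for a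
    using ev [OF that] herm_form_ratio_pos A B by blast
  have pos: "1 + s * a > 0" if "a \<in># as" "0 \<le> s" "s \<le> 1" for a s
  proof -
    have "1 + s * a = (1 - s) + s * (1 + a)"
      by (simp add: algebra_simps)
    also have "\<dots> > 0"
      using 1 [OF that(1)] that(2,3)
      by (cases "s = 0") (auto intro!: add_nonneg_pos)
    finally show ?thesis .
  qed
  have ln_det: "ln (Re (det (A + s *\<^sub>R (B - A)))) = ln (Re (det A)) + (\<Sum>a\<in>#as. ln (1 + s * a))"
    if "0 \<le> s" "s \<le> 1" for s
  proof -
    have "Re (det (A + s *\<^sub>R (B - A))) = Re (det A) * (\<Prod>a\<in>#as. 1 + s * a)"
      by (simp add: as)
    moreover have "(\<Prod>a\<in>#as. 1 + s * a) > 0"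
      using pos that by (intro prod_mset_pos) auto
    ultimately show ?thesis
      using det_pos_def [OF A] pos that by (simp add: ln_mult_pos ln_prod_mset)
  qed
  have "t * (\<Sum>a\<in>#as. ln (1 + 1 * a)) = (\<Sum>a\<in>#as. t * ln (1 + 1 * a))"
    by (simp add: sum_mset_distrib_left)
  also have "\<dots> \<le> (\<Sum>a\<in>#as. ln (1 + t * a))"
  proof (rule sum_mset_mono)
    fix a assume "a \<in># as"
    \<comment> \<open>The point at parameter \<open>t\<close> between 1 and \<open>1 + a\<close> is
      \<open>1 + t * a\<close>, and \<open>ln 1 = 0\<close> removes the first term.\<close>
    have "(1 - t) * ln 1 + t * ln (1 + a) \<le> ln ((1 - t) *\<^sub>R 1 + t *\<^sub>R (1 + a))"
      using 1 [OF \<open>a \<in># as\<close>] t concave_onD [OF ln_concave, of t 1 "1 + a"] by simp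
    then show "t * ln (1 + 1 * a) \<le> ln (1 + t * a)"
      by (simp add: algebra_simps)
  qed
  finally have "t * (ln (Re (det B)) - ln (Re (det A))) \<le>
      ln (Re (det (A + t *\<^sub>R (B - A)))) - ln (Re (det A))"
    using ln_det [of 1] ln_det [OF t] by simp
  moreover have "A + t *\<^sub>R (B - A) = (1 - t) *\<^sub>R A + t *\<^sub>R B"
    by (simp add: algebra_simps)
  ultimately show ?thesis
    by (simp add: algebra_simps)
qed

section \<open>Power and rate on segments of covariance families\<close>

definition interpolate :: "real \<Rightarrow> ('k \<Rightarrow> 'a::real_vector) \<Rightarrow> ('k \<Rightarrow> 'a) \<Rightarrow> 'k \<Rightarrow> 'a" where
  "interpolate t Q Q' = (\<lambda>i. (1 - t) *\<^sub>R Q i + t *\<^sub>R Q' i)"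

lemma covariances_zero: "covariances (\<lambda>_. 0)"
  by (simp add: covariances_def pos_semidef_zero)

lemma covariances_interpolate:
  "covariances Q \<Longrightarrow> covariances Q' \<Longrightarrow> 0 \<le> t \<Longrightarrow> t \<le> 1 \<Longrightarrow> covariances (interpolate t Q Q')"
  by (simp add: covariances_def interpolate_def pos_semidef_add pos_semidef_scaleR)

lemma sum_power_nonneg: "covariances Q \<Longrightarrow> sum_power Q \<ge> 0"
  by (simp add: covariances_def sum_power_def sum_nonneg pos_semidef_trace)

lemma sum_power_zero: "sum_power (\<lambda>_. 0) = 0"
  by (simp add: sum_power_def trace_def)

lemma sum_power_eq_0:
  assumes "covariances Q" "sum_power Q = 0"
  shows "Q = (\<lambda>_. 0)"
proof
  fix i
  have "\<forall>i\<in>UNIV. Re (trace (Q i)) = 0"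
    using assms pos_semidef_trace unfolding sum_power_def covariances_def
    by (subst sum_nonneg_eq_0_iff [symmetric]) auto
  then show "Q i = 0"
    using assms(1) pos_semidef_trace_zero by (auto simp: covariances_def)
qed

lemma sum_power_interpolate:
  "sum_power (interpolate t Q Q') = (1 - t) * sum_power Q + t * sum_power Q'"
  by (simp add: sum_power_def interpolate_def trace_def sum.distrib sum_distrib_left)

lemma matrix_add_rdistrib: "(A + B) ** C = A ** C + B ** C"
  by (simp add: matrix_matrix_mult_def vec_eq_iff distrib_right sum.distrib)

lemma rate_matrix_interpolate:
  "rate_matrix \<sigma>sq H (interpolate t Q Q') =
   (1 - t) *\<^sub>R rate_matrix \<sigma>sq H Q + t *\<^sub>R rate_matrix \<sigma>sq H Q'"
proof -
  have sum: "(\<Sum>i\<in>UNIV. conj_transpose (H i) ** interpolate t Q Q' i ** H i) =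
    (1 - t) *\<^sub>R (\<Sum>i\<in>UNIV. conj_transpose (H i) ** Q i ** H i) +
    t *\<^sub>R (\<Sum>i\<in>UNIV. conj_transpose (H i) ** Q' i ** H i)"
    by (simp add: interpolate_def matrix_add_ldistrib matrix_add_rdistrib matrix_scalar_ac
        sum.distrib scaleR_sum_right flip: scalar_matrix_assoc)
  show ?thesis
    unfolding rate_matrix_def sum by (simp add: algebra_simps diff_divide_distrib)
qed

text \<open>A nonnegative multiple of a sum of congruences of positive semidefinite matrices remains
  after removing the identity. This serves both positive definiteness of the rate matrix and
  nonnegativity of the rate.\<close>

lemma pos_semidef_rate_matrix_diff:
  assumes Q: "covariances Q" and "\<sigma>sq > 0"
  shows "pos_semidef (rate_matrix \<sigma>sq H Q - mat 1)"
proof -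
  have "hermitian (rate_matrix \<sigma>sq H Q - mat 1)"
    using hermitian_diff hermitian_rate_matrix [OF Q] pos_def_mat_1 pos_def_def by blast
  moreover have "Re (herm_form (rate_matrix \<sigma>sq H Q - mat 1) x) \<ge> 0" for x
    using assms by (simp add: rate_matrix_def herm_form_scaleR herm_form_sum herm_form_congruence
        covariances_def pos_semidef_iff sum_nonneg)
  ultimately show ?thesis
    by (simp add: pos_semidef_iff)
qed

lemma pos_def_rate_matrix:
  assumes Q: "covariances Q" and "\<sigma>sq > 0"
  shows "pos_def (rate_matrix \<sigma>sq H Q)"
proof -
  have "Re (herm_form (rate_matrix \<sigma>sq H Q - mat 1) x) \<ge> 0" for x
    using pos_semidef_rate_matrix_diff [OF assms] unfolding pos_semidef_iff by blast
  then show ?thesis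
    using hermitian_rate_matrix [OF Q] pos_def_mat_1 unfolding pos_def_def herm_form_diff
    by (smt (verit, best) minus_complex.simps(1))
qed

lemma sum_rate_nonneg:
  assumes "covariances Q" "\<sigma>sq > 0" "W > 0"
  shows "sum_rate W \<sigma>sq H Q \<ge> 0"
  using det_one_plus_pos_semidef_ge_1 [OF pos_semidef_rate_matrix_diff [OF assms(1,2), of H]] assms(3)
  by (simp add: sum_rate_def)

lemma sum_rate_zero: "sum_rate W \<sigma>sq H (\<lambda>_. 0) = 0"
  by (simp add: sum_rate_def rate_matrix_def)

text \<open>The rate matrix is affine in the covariances, so concavity of \<open>ln det\<close>
  carries over, scaled by the positive factor \<open>W / ln 2\<close>.\<close>

lemma sum_rate_concave:
  assumes Q: "covariances Q" "covariances Q'" and "\<sigma>sq > 0" "W > 0" and t: "0 \<le> t" "t \<le> 1"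
  shows "(1 - t) * sum_rate W \<sigma>sq H Q + t * sum_rate W \<sigma>sq H Q' \<le>
    sum_rate W \<sigma>sq H (interpolate t Q Q')"
proof -
  have "W / ln 2 * ((1 - t) * ln (Re (det (rate_matrix \<sigma>sq H Q))) + t * ln (Re (det (rate_matrix \<sigma>sq H Q'))))
    \<le> W / ln 2 * ln (Re (det (rate_matrix \<sigma>sq H (interpolate t Q Q'))))"
    unfolding rate_matrix_interpolate
    using \<open>W > 0\<close> log_det_concave [OF pos_def_rate_matrix pos_def_rate_matrix t] Q \<open>\<sigma>sq > 0\<close>
    by (intro mult_left_mono) auto
  then show ?thesis
    by (simp add: sum_rate_def log_def field_simps)
qed

section \<open>Energy efficiency along segments and the rate at minimal power\<close>

text \<open>For a fixed level \<open>g\<close>, clearing the positive denominator turns the bound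
  into \<open>g * d X \<le> R X\<close>; with \<open>d\<close> affine and \<open>R\<close> concave
  it passes from the endpoints to the segment.\<close>

lemma energy_efficiency_quasiconcave:
  assumes Q: "covariances Q" "covariances Q'" and pos: "\<sigma>sq > 0" "W > 0" "\<eta> > 0" "Pc > 0"
    and t: "0 \<le> t" "t \<le> 1"
    and le: "energy_efficiency W \<sigma>sq \<eta> Pc H Q \<le> energy_efficiency W \<sigma>sq \<eta> Pc H Q'"
  shows "energy_efficiency W \<sigma>sq \<eta> Pc H Q \<le> energy_efficiency W \<sigma>sq \<eta> Pc H (interpolate t Q Q')"
proof -
  define d where "d X = sum_power X / \<eta> + Pc" for X :: "'a \<Rightarrow> complex^'b^'b"
  define g where "g = energy_efficiency W \<sigma>sq \<eta> Pc H Q"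
  have d: "d X > 0" if "covariances X" for X
    using sum_power_nonneg [OF that] pos by (simp add: d_def add_nonneg_pos)
  have R: "g * d X \<le> sum_rate W \<sigma>sq H X \<longleftrightarrow> g \<le> energy_efficiency W \<sigma>sq \<eta> Pc H X"
    if "covariances X" for X
    using d [OF that] by (simp add: energy_efficiency_def d_def [symmetric] pos_le_divide_eq)
  have "d (interpolate t Q Q') = (1 - t) * d Q + t * d Q'"
    by (simp add: d_def sum_power_interpolate add_divide_distrib diff_divide_distrib algebra_simps)
  then have "g * d (interpolate t Q Q') = (1 - t) * (g * d Q) + t * (g * d Q')"
    by (simp only: distrib_left mult.left_commute)
  also have "\<dots> \<le> (1 - t) * sum_rate W \<sigma>sq H Q + t * sum_rate W \<sigma>sq H Q'"
    using R Q t le by (intro add_mono mult_left_mono) (auto simp: g_def)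
  also have "\<dots> \<le> sum_rate W \<sigma>sq H (interpolate t Q Q')"
    using sum_rate_concave Q pos t by blast
  finally show ?thesis
    using R covariances_interpolate [OF Q t] by (simp add: g_def)
qed

text \<open>Nonnegativity of the larger rate matters: only then does shrinking the positive
  denominator not lower the quotient.\<close>

lemma energy_efficiency_mono:
  assumes "covariances Q'" "\<eta> > 0" "Pc > 0"
    and "sum_power Q' \<le> sum_power Q" "sum_rate W \<sigma>sq H Q \<le> sum_rate W \<sigma>sq H Q'"
    and "sum_rate W \<sigma>sq H Q' \<ge> 0"
  shows "energy_efficiency W \<sigma>sq \<eta> Pc H Q \<le> energy_efficiency W \<sigma>sq \<eta> Pc H Q'"
  unfolding energy_efficiency_def
  using assms sum_power_nonneg [OF assms(1)]
  by (intro frac_le) (auto simp: divide_right_mono intro!: add_nonneg_pos)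

lemma interpolate_at_power:
  assumes "sum_power Q \<le> P \<and> P \<le> sum_power Q' \<or> sum_power Q' \<le> P \<and> P \<le> sum_power Q"
  obtains t where "0 \<le> t" "t \<le> 1" "sum_power (interpolate t Q Q') = P"
proof (cases "sum_power Q = sum_power Q'")
  \<comment> \<open>Equal powers force \<open>P\<close> to be that common value, so any
    \<open>t\<close> works; the linear equation for \<open>t\<close> in the other case would divide
    by zero here.\<close>
  case True
  then show ?thesis
    using assms that [of 0] by (simp add: sum_power_interpolate)
next
  case False
  define t where "t = (P - sum_power Q) / (sum_power Q' - sum_power Q)"
  have "t * (sum_power Q' - sum_power Q) = P - sum_power Q"
    using False by (simp add: t_def)
  then have "sum_power (interpolate t Q Q') = P"
    by (simp add: sum_power_interpolate algebra_simps)
  moreover have "0 \<le> t" "t \<le> 1"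
    using assms False by (auto simp: t_def zero_le_divide_iff divide_le_eq_1)
  ultimately show ?thesis
    using that by blast
qed

text \<open>A larger rate at the same power would exceed \<open>Cmin\<close>, and scaling down would
  then contradict minimality. With zero power there is nothing to save, but then both families are
  zero.\<close>

lemma sum_rate_le_min_power:
  fixes Q Qbar :: "'k::finite \<Rightarrow> complex^'n^'n"
  assumes pos: "\<sigma>sq > 0" "W > 0" "Cmin \<ge> 0"
    and Qbar: "is_arg_min sum_power (\<lambda>Q. covariances Q \<and> sum_rate W \<sigma>sq H Q \<ge> Cmin) Qbar"
    and Q: "covariances Q" and P: "sum_power Q = sum_power Qbar"
  shows "sum_rate W \<sigma>sq H Q \<le> sum_rate W \<sigma>sq H Qbar"
proof (cases "sum_power Q = 0")
  case True
  then have "Q = (\<lambda>_. 0)" "Qbar = (\<lambda>_. 0)"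
    using sum_power_eq_0 Q P Qbar by (auto simp: is_arg_min_def)
  then show ?thesis by simp
next
  case False
  then have pQ: "sum_power Q > 0"
    using sum_power_nonneg [OF Q] by simp
  show ?thesis
  proof (rule ccontr)
    assume "\<not> ?thesis"
    then have R: "Cmin < sum_rate W \<sigma>sq H Q"
      using Qbar by (auto simp: is_arg_min_def)
    \<comment> \<open>The rate at the zero family is 0, so by concavity scaling \<open>Q\<close> by
      \<open>t\<close> keeps a rate of at least \<open>t\<close> times that of \<open>Q\<close>,
      which is \<open>Cmin\<close>.\<close>
    define t where "t = Cmin / sum_rate W \<sigma>sq H Q"
    have t: "0 \<le> t" "t < 1" "t * sum_rate W \<sigma>sq H Q = Cmin"
      using R pos by (auto simp: t_def)
    let ?Q = "interpolate t (\<lambda>_. 0) Q"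
    have "covariances ?Q"
      using covariances_interpolate [OF covariances_zero Q] t by simp
    moreover have "sum_rate W \<sigma>sq H ?Q \<ge> Cmin"
      using sum_rate_concave [OF covariances_zero Q pos(1,2) t(1), of H] t by (simp add: sum_rate_zero)
    ultimately have "sum_power Qbar \<le> sum_power ?Q"
      using Qbar by (auto simp: is_arg_min_linorder)
    also have "\<dots> < sum_power Qbar"
      using t pQ P by (simp add: sum_power_interpolate sum_power_zero)
    finally show False by simp
  qed
qed

section \<open>The four cases of the constrained problem\<close>

theorem mainTheorem3:
  fixes W \<sigma>sq \<eta> Pmax Cmin Pdyn Psta Pc :: real
    and H :: "'k::finite \<Rightarrow> complex^'m^'n"
    and Qstar Qhat Qbar :: "'k \<Rightarrow> complex^'n^'n"
  assumes "W > 0" and "\<sigma>sq > 0" and "\<eta> > 0" and "Pmax > 0" and "Cmin \<ge> 0"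
    and Pc: "Pc = real CARD('m) * Pdyn + Psta" and "Pc > 0"
    and H: "\<And>i. H i \<noteq> 0"
    and Qstar: "is_arg_max (energy_efficiency W \<sigma>sq \<eta> Pc H) covariances Qstar"
    and Qhat: "is_arg_max (sum_rate W \<sigma>sq H) (\<lambda>Q. covariances Q \<and> sum_power Q \<le> Pmax) Qhat"
    and Qbar: "is_arg_min sum_power (\<lambda>Q. covariances Q \<and> sum_rate W \<sigma>sq H Q \<ge> Cmin) Qbar"
  shows "(sum_power Qbar \<le> sum_power Qstar \<and> sum_power Qstar \<le> Pmax \<longrightarrow>
            is_arg_max (energy_efficiency W \<sigma>sq \<eta> Pc H) (feasible W \<sigma>sq Pmax Cmin H) Qstar)
       \<and> (sum_power Qstar \<ge> Pmax \<and> Pmax \<ge> sum_power Qbar \<longrightarrow>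
            is_arg_max (energy_efficiency W \<sigma>sq \<eta> Pc H) (feasible W \<sigma>sq Pmax Cmin H) Qhat)
       \<and> (sum_power Qstar \<le> sum_power Qbar \<and> sum_power Qbar \<le> Pmax \<longrightarrow>
            is_arg_max (energy_efficiency W \<sigma>sq \<eta> Pc H) (feasible W \<sigma>sq Pmax Cmin H) Qbar)
       \<and> (sum_power Qbar > Pmax \<longrightarrow> \<not> (\<exists>Q. feasible W \<sigma>sq Pmax Cmin H Q))"
proof -
  let ?g = "energy_efficiency W \<sigma>sq \<eta> Pc H" and ?R = "sum_rate W \<sigma>sq H"
  note pos = \<open>\<sigma>sq > 0\<close> \<open>W > 0\<close> \<open>\<eta> > 0\<close> \<open>Pc > 0\<close>
  have star: "covariances Qstar" "\<And>Q. covariances Q \<Longrightarrow> ?g Q \<le> ?g Qstar"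
    using Qstar by (auto simp: is_arg_max_linorder)
  have hat: "covariances Qhat" "sum_power Qhat \<le> Pmax"
    "\<And>Q. covariances Q \<Longrightarrow> sum_power Q \<le> Pmax \<Longrightarrow> ?R Q \<le> ?R Qhat"
    using Qhat by (auto simp: is_arg_max_linorder)
  have bar: "covariances Qbar" "?R Qbar \<ge> Cmin"
    "\<And>Q. covariances Q \<Longrightarrow> ?R Q \<ge> Cmin \<Longrightarrow> sum_power Qbar \<le> sum_power Q"
    using Qbar by (auto simp: is_arg_min_linorder)
  have nonneg: "?R Q \<ge> 0" if "covariances Q" for Q
    using that pos by (intro sum_rate_nonneg)
  \<comment> \<open>Replaces \<open>Q\<close> by a point of prescribed power on the way to
    \<open>Qstar\<close>, at no loss of efficiency.\<close>
  have segment: "\<exists>Q'. covariances Q' \<and> sum_power Q' = P \<and> ?g Q \<le> ?g Q'"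
    if Q: "covariances Q" and P: "sum_power Q \<le> P \<and> P \<le> sum_power Qstar \<or> sum_power Qstar \<le> P \<and> P \<le> sum_power Q"
    for Q P
  proof -
    obtain t where t: "0 \<le> t" "t \<le> 1" "sum_power (interpolate t Q Qstar) = P"
      using P by (rule interpolate_at_power)
    then show ?thesis
      using energy_efficiency_quasiconcave [OF Q star(1) pos t(1,2) star(2) [OF Q]]
        covariances_interpolate [OF Q star(1) t(1,2)] by blast
  qed
  have i: "is_arg_max ?g (feasible W \<sigma>sq Pmax Cmin H) Qstar"
    if P: "sum_power Qbar \<le> sum_power Qstar" "sum_power Qstar \<le> Pmax"
  proof -
    \<comment> \<open>Otherwise \<open>Qbar\<close> would have a strictly larger rate at no more
      power, hence beat the global maximizer.\<close>
    have "?R Qstar \<ge> Cmin"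
    proof (rule ccontr)
      assume "\<not> ?thesis"
      then have "?R Qstar < ?R Qbar"
        using bar by simp
      moreover have d: "sum_power Qbar / \<eta> + Pc > 0" "sum_power Qbar / \<eta> \<le> sum_power Qstar / \<eta>"
        using sum_power_nonneg [OF bar(1)] pos P by (auto intro!: add_nonneg_pos divide_right_mono)
      ultimately have "?g Qstar < ?g Qbar"
        unfolding energy_efficiency_def using nonneg [OF star(1)]
        by (intro frac_less) auto
      then show False
        using star(2) [OF bar(1)] by simp
    qed
    then show ?thesis
      using star P by (auto simp: is_arg_max_linorder feasible_def)
  qed
  have ii: "is_arg_max ?g (feasible W \<sigma>sq Pmax Cmin H) Qhat"
    if P: "sum_power Qstar \<ge> Pmax" "Pmax \<ge> sum_power Qbar"
  proof -
    have "?g Q \<le> ?g Qhat" if Q: "feasible W \<sigma>sq Pmax Cmin H Q" for Q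
    proof -
      \<comment> \<open>\<open>Q\<close> lies below and \<open>Qstar\<close> above the power budget;
        at exactly the level \<open>Pmax\<close>, \<open>Qhat\<close> has at least the rate of
        \<open>Q'\<close> and no more power.\<close>
      obtain Q' where Q': "covariances Q'" "sum_power Q' = Pmax" "?g Q \<le> ?g Q'"
        using segment [of Q Pmax] Q P by (auto simp: feasible_def)
      moreover have "?g Q' \<le> ?g Qhat"
        using Q' hat pos nonneg by (intro energy_efficiency_mono) auto
      ultimately show ?thesis by simp
    qed
    moreover have "?R Qhat \<ge> Cmin"
      using hat(3) [OF bar(1)] bar(2) P by simp
    ultimately show ?thesis
      using hat by (auto simp: is_arg_max_linorder feasible_def)
  qed
  have iii: "is_arg_max ?g (feasible W \<sigma>sq Pmax Cmin H) Qbar"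
    if P: "sum_power Qstar \<le> sum_power Qbar" "sum_power Qbar \<le> Pmax"
  proof -
    have "?g Q \<le> ?g Qbar" if Q: "feasible W \<sigma>sq Pmax Cmin H Q" for Q
    proof -
      \<comment> \<open>A feasible \<open>Q\<close> needs at least the power of \<open>Qbar\<close>,
        so the segment down to \<open>Qstar\<close> meets that level.\<close>
      obtain Q' where Q': "covariances Q'" "sum_power Q' = sum_power Qbar" "?g Q \<le> ?g Q'"
        using segment [of Q "sum_power Qbar"] Q P bar(3) by (auto simp: feasible_def)
      moreover have "?R Q' \<le> ?R Qbar"
        using sum_rate_le_min_power [OF _ _ _ Qbar] Q' pos \<open>Cmin \<ge> 0\<close> by blast
      then have "?g Q' \<le> ?g Qbar"
        using Q' bar pos nonneg by (intro energy_efficiency_mono) auto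
      ultimately show ?thesis by simp
    qed
    then show ?thesis
      using bar P by (auto simp: is_arg_max_linorder feasible_def)
  qed
  have iv: "\<not> (\<exists>Q. feasible W \<sigma>sq Pmax Cmin H Q)" if "sum_power Qbar > Pmax"
    using that bar(3) by (fastforce simp: feasible_def)
  show ?thesis
    using i ii iii iv by blast
qed

end
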